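(* Let $k$ and $m$ be integers such that $2\le k\le m\le 2k-2$. If $S$ is a $(k,m)$-agreeable cylindrical society, then $$a(S)\ge\frac{|S|-m+k+1}{2}.$$
   Context: A society is a triple $(X,V,\mathcal{A})$ consisting of a set $X$ (the spectrum, whose elements are called platforms), a finite set $V$ of voters, and a collection $\mathcal{A}=\{A_v\}_{v\in V}$ indexed by the voters, where $A_v\subseteq X$ is the approval set of voter $v$ (different voters may have equal approval sets). The size $|S|$ of a society $S$ is its number of voters. The agreement number $a(S)$ is the greatest number of voters that approve a single platform, i.e. $a(S)=\max_{p\in X}|\{v\in V: p\in A_v\}|$. For integers $1\le k\le m\le|S|$, the society is $(k,m)$-agreeable if among every $m$ voters there are $k$ voters whose approval sets have a common platform; being $(k,m)$-agreeable includes $m\le |S|$. A linear society has as spectrum a closed subset of $\mathbb{R}$, and its approval sets are closed and bounded intervals of $\mathbb{R}$ (contained in the spectrum). A circular society has as spectrum a circle, and its approval sets are connected subsets of the circle. Given societies $(X,V,\{A^X_v\})$ and $(Y,V,\{A^Y_v\})$ with the same voters $V$, their product society is $(X\times Y,V,\mathcal{A}^{X\times Y})$, where $\mathcal{A}^{X\times Y}=\{A^X_v\times A^Y_v\mid v\in V\}$. A cylindrical society is a product of a linear society and a circular society. *)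

theory Defs
  imports "HOL-Analysis.Analysis"
begin

record ('p, 'v) society =
  spectrum :: "'p set"
  voters :: "'v set"
  approval :: "'v \<Rightarrow> 'p set"

text \<open>The values of \<open>approval S\<close> outside \<open>voters S\<close> are irrelevant. Approval sets may be empty.\<close>

definition society :: "('p, 'v) society \<Rightarrow> bool" where
  "society S \<longleftrightarrow> finite (voters S) \<and> (\<forall>v\<in>voters S. approval S v \<subseteq> spectrum S)"

definition society_size :: "('p, 'v) society \<Rightarrow> nat" where
  "society_size S = card (voters S)"

text \<open>For a society with nonempty spectrum this is the maximum of a finite nonempty set of numbers.
  An agreeable society, as defined below, has a nonempty spectrum.\<close>

definition agreement_number :: "('p, 'v) society \<Rightarrow> nat" where
  "agreement_number S = Max ((\<lambda>p. card {v \<in> voters S. p \<in> approval S v}) ` spectrum S)"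

definition agreeable :: "nat \<Rightarrow> nat \<Rightarrow> ('p, 'v) society \<Rightarrow> bool" where
  "agreeable k m S \<longleftrightarrow> 1 \<le> k \<and> k \<le> m \<and> m \<le> society_size S \<and>
     (\<forall>M. M \<subseteq> voters S \<and> card M = m \<longrightarrow>
        (\<exists>K. K \<subseteq> M \<and> card K = k \<and> (\<exists>p\<in>spectrum S. \<forall>v\<in>K. p \<in> approval S v)))"

definition linear_society :: "(real, 'v) society \<Rightarrow> bool" where
  "linear_society S \<longleftrightarrow> society S \<and> closed (spectrum S) \<and>
     (\<forall>v\<in>voters S. \<exists>a b. approval S v = {a..b})"

definition circular_society :: "(complex, 'v) society \<Rightarrow> bool" where
  "circular_society S \<longleftrightarrow> society S \<and> (\<exists>c r. 0 < r \<and> spectrum S = sphere c r) \<and>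
     (\<forall>v\<in>voters S. connected (approval S v))"

text \<open>A relation rather than an equation between records, so that \<open>approval S\<close> is constrained
  on the voters only.\<close>

definition is_product_society ::
    "('p \<times> 'q, 'v) society \<Rightarrow> ('p, 'v) society \<Rightarrow> ('q, 'v) society \<Rightarrow> bool" where
  "is_product_society S X Y \<longleftrightarrow>
     voters X = voters S \<and> voters Y = voters S \<and>
     spectrum S = spectrum X \<times> spectrum Y \<and>
     (\<forall>v\<in>voters S. approval S v = approval X v \<times> approval Y v)"

definition cylindrical_society :: "(real \<times> complex, 'v) society \<Rightarrow> bool" where
  "cylindrical_society S \<longleftrightarrow>
     (\<exists>L C. linear_society L \<and> circular_society C \<and> is_product_society S L C)"

end

theory Submission
  imports Defs
begin

text \<open>
  Join two voters when their approval sets meet.  Voters who approve a common platform form a clique of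
  this graph, so every set of \<open>m\<close> voters contains a clique of size \<open>k\<close>.  The proof has a graph-theoretic
  and a geometric half.

  The graph-theoretic half (\<open>clique_of_cliques_in_small_sets\<close>) says that for \<open>m \<le> 2 * k - 2\<close> such
  a graph on \<open>n\<close> vertices has a clique of size \<open>n - m + k\<close>: all but \<open>m - k\<close> vertices form a
  clique, as holds locally.  In the complement graph this is a local-to-global principle for the vertex cover
  number \<open>\<tau>\<close>: a minimal graph with \<open>\<tau> = t + 1\<close> has at most \<open>2 * (t + 1)\<close> vertices.  That in turn
  follows from Hajnal's theorem that a nonempty family \<open>F\<close> of cliques of the maximum size \<open>\<alpha>\<close> satisfies
  \<open>card (\<Inter>F) + card (\<Union>F) \<ge> 2 * \<alpha>\<close> (\<open>card_Inter_add_card_Union_maximum_cliques\<close>).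

  The geometric half looks at a clique of \<open>w\<close> voters.  Their approval sets are products of an
  interval and an arc, and two products meet exactly when both factors meet.  Pairwise meeting intervals
  have a common point (\<open>common_point_of_meeting_intervals\<close>).  Pairwise meeting arcs need not have one,
  but a shortest arc contains no other arc properly, so every arc contains one of its two ends,
  and it contains both; hence one end lies in at least \<open>(w + 1) / 2\<close> arcs
  (\<open>half_of_meeting_arcs\<close>).  With \<open>w \<ge> n - m + k\<close> this is the claimed bound.
\<close>

section \<open>Large cliques from cliques in small sets\<close>

text \<open>
  Adding a maximum clique \<open>A\<close> to a family with intersection \<open>I\<close> and union \<open>U\<close> removes
  \<open>I - A\<close> from the intersection and adds \<open>A - U\<close> to the union, so it suffices that
  \<open>card (I - A) \<le> card (A - U)\<close>.  This is an exchange argument: an element of \<open>A \<inter> U\<close> lies in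
  some member \<open>B\<close> of the family, and \<open>I \<subseteq> B\<close>, so trading \<open>A - U\<close> for \<open>I - A\<close> in \<open>A\<close> gives
  a clique again, which cannot be larger than \<open>A\<close>.  This is Hajnal's theorem, stated for cliques
  instead of independent sets.
\<close>

lemma card_Inter_add_card_Union_maximum_cliques:
  fixes R :: "('v \<times> 'v) set"
  assumes "finite F" "F \<noteq> {}" "finite W"
    and F: "\<And>A. A \<in> F \<Longrightarrow> A \<subseteq> W \<and> A \<times> A \<subseteq> R \<and> card A = \<alpha>"
    and max: "\<And>A. A \<subseteq> W \<Longrightarrow> A \<times> A \<subseteq> R \<Longrightarrow> card A \<le> \<alpha>"
  shows "2 * \<alpha> \<le> card (\<Inter>F) + card (\<Union>F)"
  using assms(1,2) F
proof (induction F rule: finite_ne_induct)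
  case (singleton A)
  then show ?case by simp
next
  case (insert A F)
  let ?I = "\<Inter>F" and ?U = "\<Union>F"
  have A: "A \<subseteq> W" "A \<times> A \<subseteq> R" "card A = \<alpha>"
    and FW: "\<And>B. B \<in> F \<Longrightarrow> B \<subseteq> W \<and> B \<times> B \<subseteq> R"
    using insert.prems by auto
  have IH: "2 * \<alpha> \<le> card ?I + card ?U"
    using insert.IH insert.prems by auto
  have UW: "?U \<subseteq> W" using FW by blast
  have IU: "?I \<subseteq> ?U" using insert.hyps by blast
  have fin: "finite A" "finite ?U" "finite ?I"
    using A(1) UW IU \<open>finite W\<close> by (meson finite_subset)+
  let ?B = "(A \<inter> ?U) \<union> (?I - A)"
  have "?B \<times> ?B \<subseteq> R"
  proof
    fix z assume "z \<in> ?B \<times> ?B"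
    then obtain x y where z: "z = (x, y)" "x \<in> ?B" "y \<in> ?B" by blast
    show "z \<in> R"
    proof (cases "x \<in> A \<and> y \<in> A")
      case True
      then show ?thesis using A z by blast
    next
      case False
      then obtain B where "B \<in> F" "x \<in> B" "y \<in> B"
        using z insert.hyps by blast
      then show ?thesis using FW z by blast
    qed
  qed
  then have "card ?B \<le> \<alpha>"
    using A UW IU by (intro max) auto
  moreover have "card ?B = card (A \<inter> ?U) + card (?I - A)"
    using fin by (intro card_Un_disjoint) auto
  moreover have "card A = card (A \<inter> ?U) + card (A - ?U)"
    using fin by (metis card_Int_Diff)
  ultimately have "card (?I - A) \<le> card (A - ?U)"
    using A by simp
  moreover have "card ?I = card (?I \<inter> A) + card (?I - A)"
    using fin by (metis card_Int_Diff)
  moreover have "card (A \<union> ?U) = card ?U + card (A - ?U)"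
    using fin card_Un_disjoint[of ?U "A - ?U"] by (simp add: Un_commute)
  ultimately have "2 * \<alpha> \<le> card (?I \<inter> A) + card (A \<union> ?U)"
    using IH by linarith
  then show ?case by (simp add: Int_commute)
qed

text \<open>
  Call \<open>card W - card K\<close>, for a maximum clique \<open>K\<close> of \<open>W\<close>, the deficiency of \<open>W\<close>.  The hypothesis bounds
  the deficiency by \<open>m - k\<close> on all sets of size \<open>m\<close>, hence also on all smaller sets, and the conclusion
  is the same bound for \<open>V\<close>.  In a smallest set that violates the bound, deleting a vertex
  lowers the deficiency, so every vertex is missed by some maximum clique and the intersection of the
  maximum cliques is empty.  The previous lemma then makes the size of such a set at most
  twice its deficiency \<open>m - k + 1\<close>, which is at most \<open>m\<close>: a set so small obeys the bound.
\<close>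

lemma clique_of_cliques_in_small_sets:
  fixes R :: "('v \<times> 'v) set"
  assumes "finite V" "m \<le> card V" "k \<le> m" "m + 2 \<le> 2 * k"
    and local: "\<And>M. M \<subseteq> V \<Longrightarrow> card M = m \<Longrightarrow> \<exists>K\<subseteq>M. card K = k \<and> K \<times> K \<subseteq> R"
  obtains K where "K \<subseteq> V" "K \<times> K \<subseteq> R" "card V - (m - k) \<le> card K"
proof (rule ccontr)
  assume "\<not> thesis"
  define t where "t = m - k"
  define bad where
    "bad W \<longleftrightarrow> W \<subseteq> V \<and> (\<forall>K\<subseteq>W. K \<times> K \<subseteq> R \<longrightarrow> card K + t + 1 \<le> card W)" for W
  have "bad V"
    unfolding bad_def
  proof (intro conjI allI impI subset_refl)
    fix K assume "K \<subseteq> V" "K \<times> K \<subseteq> R"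
    then have "\<not> card V - t \<le> card K"
      using that \<open>\<not> thesis\<close> t_def by blast
    then show "card K + t + 1 \<le> card V" by linarith
  qed
  then obtain W where W: "bad W" and minW: "\<And>W'. bad W' \<Longrightarrow> card W \<le> card W'"
    using ex_has_least_nat[of bad V card] by blast
  have WV: "W \<subseteq> V" and cliqueW: "\<And>K. K \<subseteq> W \<Longrightarrow> K \<times> K \<subseteq> R \<Longrightarrow> card K + t + 1 \<le> card W"
    using W unfolding bad_def by auto
  have finW: "finite W" using WV \<open>finite V\<close> finite_subset by blast
  have "t + 1 \<le> card W" using cliqueW[of "{}"] by simp
  define \<alpha> where "\<alpha> = card W - t - 1"
  define F where "F = {K. K \<subseteq> W \<and> K \<times> K \<subseteq> R \<and> card K = \<alpha>}"
  have avoid: "\<exists>K\<in>F. v \<notin> K" if "v \<in> W" for v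
  proof -
    have card': "card W = Suc (card (W - {v}))"
      using that finW by (metis card.remove)
    then have "\<not> bad (W - {v})" using minW by fastforce
    then obtain K where K: "K \<subseteq> W - {v}" "K \<times> K \<subseteq> R" "card (W - {v}) < card K + t + 1"
      using WV unfolding bad_def by (meson Diff_subset not_le order_trans)
    moreover have "card K + t + 1 \<le> card W" using K by (intro cliqueW) auto
    ultimately have "card K = \<alpha>" using card' \<alpha>_def by linarith
    then show ?thesis using K F_def by blast
  qed
  have "W \<noteq> {}" using \<open>t + 1 \<le> card W\<close> by auto
  then have "F \<noteq> {}" using avoid by blast
  moreover have "finite F" unfolding F_def using finW by simp
  ultimately have "2 * \<alpha> \<le> card (\<Inter>F) + card (\<Union>F)"
  proof (intro card_Inter_add_card_Union_maximum_cliques[OF _ _ finW, where R = R])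
    show "card A \<le> \<alpha>" if "A \<subseteq> W" "A \<times> A \<subseteq> R" for A
      using cliqueW[OF that] \<alpha>_def by linarith
  qed (auto simp: F_def)
  moreover have "\<Inter>F = {}"
  proof -
    obtain A where "A \<in> F" "A \<subseteq> W" using \<open>F \<noteq> {}\<close> F_def by auto
    then show ?thesis using avoid by fastforce
  qed
  moreover have "card (\<Union>F) \<le> card W"
    using finW by (intro card_mono) (auto simp: F_def)
  ultimately have "card W \<le> 2 * t + 2"
    using \<open>t + 1 \<le> card W\<close> \<alpha>_def by auto
  then have "card W \<le> m" using assms(3,4) t_def by linarith
  then obtain M where M: "W \<subseteq> M" "M \<subseteq> V" "card M = m"
    using exists_subset_between[of W m V] assms(1,2) WV by blast
  then obtain K where K: "K \<subseteq> M" "card K = k" "K \<times> K \<subseteq> R"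
    using local by blast
  have finM: "finite M" using M \<open>finite V\<close> finite_subset by blast
  have "K \<subseteq> (K \<inter> W) \<union> (M - W)" using K by blast
  then have "card K \<le> card ((K \<inter> W) \<union> (M - W))"
    using finM finW by (intro card_mono) auto
  also have "\<dots> \<le> card (K \<inter> W) + card (M - W)" by (rule card_Un_le)
  also have "card (M - W) = m - card W"
    using M finW card_Diff_subset by metis
  finally have "k \<le> card (K \<inter> W) + (m - card W)" using K by simp
  moreover have "card (K \<inter> W) + t + 1 \<le> card W"
    using K by (intro cliqueW) auto
  ultimately show False
    using \<open>card W \<le> m\<close> \<open>k \<le> m\<close> t_def by linarith
qed

section \<open>Pairwise meeting arcs\<close>

text \<open>
  A discrete arc, described without choosing a direction or end points: two points of \<open>P\<close>
  outside \<open>D\<close> cut the circle into two parts, and \<open>D\<close> lies in one of them.  The circle is cut open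
  to a linear order, so \<open>D\<close> is a segment of \<open>P\<close> or the complement of one.
\<close>

definition cyclically_convex :: "'a::linorder set \<Rightarrow> 'a set \<Rightarrow> bool" where
  "cyclically_convex P D \<longleftrightarrow>
     (\<forall>a\<in>P - D. \<forall>b\<in>P - D. a < b \<longrightarrow> D \<inter> {a<..<b} = {} \<or> D \<subseteq> {a<..<b})"

text \<open>
  The two points are the ends of the arc \<open>D\<close>.  An arc \<open>E\<close> that avoids both lies inside \<open>D\<close> or outside
  of \<open>D\<close>, and since it meets \<open>D\<close>, it is inside.  There are two cases, according to whether \<open>D\<close>
  passes through the place where the circle was cut open.
\<close>

lemma cyclically_convex_end_points:
  fixes P :: "'a::linorder set"
  assumes "finite P" "D \<subseteq> P" "D \<noteq> {}" "cyclically_convex P D"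
  obtains e f where "e \<in> D" "f \<in> D"
    "\<And>E. E \<subseteq> P \<Longrightarrow> cyclically_convex P E \<Longrightarrow> E \<inter> D \<noteq> {} \<Longrightarrow> e \<notin> E \<Longrightarrow> f \<notin> E \<Longrightarrow> E \<subset> D"
proof (cases "\<exists>x\<in>D. \<exists>z\<in>D. \<exists>y\<in>P - D. x < y \<and> y < z")
  case False
  \<comment> \<open>\<open>D\<close> is a segment of \<open>P\<close>, and its ends are its extreme elements.\<close>
  have finD: "finite D" using assms finite_subset by blast
  define e f where "e = Min D" and "f = Max D"
  have ef: "e \<in> D" "f \<in> D" and bounds: "\<And>x. x \<in> D \<Longrightarrow> e \<le> x \<and> x \<le> f"
    using finD \<open>D \<noteq> {}\<close> by (auto simp: e_def f_def)
  show ?thesis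
  proof (rule that[OF ef])
    fix E assume E: "E \<subseteq> P" "cyclically_convex P E" "E \<inter> D \<noteq> {}" "e \<notin> E" "f \<notin> E"
    then obtain x where x: "x \<in> E" "x \<in> D" by blast
    then have "e < x" "x < f" using bounds E by (metis order_le_less)+
    moreover from this have "e < f" by order
    moreover have "e \<in> P - E" "f \<in> P - E" using E ef \<open>D \<subseteq> P\<close> by auto
    ultimately have "E \<inter> {e<..<f} = {} \<or> E \<subseteq> {e<..<f}" "x \<in> E \<inter> {e<..<f}"
      using E(2) x(1) unfolding cyclically_convex_def by auto
    then have inner: "E \<subseteq> {e<..<f}" by blast
    have "E \<subseteq> D"
    proof
      fix q assume "q \<in> E"
      then have "q \<in> P" "e < q" "q < f" using inner E(1) by auto
      then show "q \<in> D" using False ef by blast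
    qed
    then show "E \<subset> D" using ef E by blast
  qed
next
  case True
  then obtain x y z where xyz: "x \<in> D" "z \<in> D" "y \<in> P" "y \<notin> D" "x < y" "y < z" by blast
  have finD: "finite D" using assms finite_subset by blast
  \<comment> \<open>\<open>D\<close> is the complement of a segment around \<open>y\<close>, and its ends are the neighbours of that segment.\<close>
  define e f where "e = Max {d \<in> D. d < y}" and "f = Min {d \<in> D. y < d}"
  have "e \<in> {d \<in> D. d < y}" unfolding e_def using finD xyz by (intro Max_in) auto
  then have e: "e \<in> D" "e < y" by auto
  have "f \<in> {d \<in> D. y < d}" unfolding f_def using finD xyz by (intro Min_in) auto
  then have f: "f \<in> D" "y < f" by auto
  have gap: "d \<le> e \<or> f \<le> d" if "d \<in> D" for d
  proof (cases "d < y")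
    case True
    then show ?thesis unfolding e_def using finD that by auto
  next
    case False
    then have "y < d" using that xyz by (metis linorder_neqE)
    then show ?thesis unfolding f_def using finD that by auto
  qed
  have outer: "q \<in> D" if "q \<in> P" "q < e \<or> f < q" for q
  proof (rule ccontr)
    assume "q \<notin> D"
    from that(2) show False
    proof
      assume "q < e"
      moreover have "q \<in> P - D" "y \<in> P - D" using that xyz \<open>q \<notin> D\<close> by auto
      ultimately have "D \<inter> {q<..<y} = {} \<or> D \<subseteq> {q<..<y}"
        using \<open>cyclically_convex P D\<close> e unfolding cyclically_convex_def
        by (meson order_less_trans)
      then show False using e f \<open>q < e\<close> by fastforce
    next
      assume "f < q"
      moreover have "q \<in> P - D" "y \<in> P - D" using that xyz \<open>q \<notin> D\<close> by auto
      ultimately have "D \<inter> {y<..<q} = {} \<or> D \<subseteq> {y<..<q}"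
        using \<open>cyclically_convex P D\<close> f unfolding cyclically_convex_def
        by (meson order_less_trans)
      then show False using e f \<open>f < q\<close> by fastforce
    qed
  qed
  show ?thesis
  proof (rule that[OF e(1) f(1)])
    fix E assume E: "E \<subseteq> P" "cyclically_convex P E" "E \<inter> D \<noteq> {}" "e \<notin> E" "f \<notin> E"
    have "e < f" using e f by order
    moreover have "e \<in> P - E" "f \<in> P - E" using e f E \<open>D \<subseteq> P\<close> by auto
    ultimately have "E \<inter> {e<..<f} = {} \<or> E \<subseteq> {e<..<f}"
      using E unfolding cyclically_convex_def by blast
    moreover have "\<not> E \<subseteq> {e<..<f}" using E(3) gap by fastforce
    ultimately have "E \<inter> {e<..<f} = {}" by blast
    then have "q < e \<or> f < q" if "q \<in> E" for q
      using that E(4,5) by (metis IntI empty_iff greaterThanLessThan_iff linorder_neqE)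
    then have "E \<subseteq> D" using outer E(1) by blast
    then show "E \<subset> D" using e E by blast
  qed
qed

text \<open>
  In an arc with the fewest points no other arc is properly contained, so every arc contains one of the
  two ends of this shortest arc.  The shortest arc itself contains both ends and is counted twice,
  which gives the \<open>+ 1\<close>.
\<close>

lemma half_of_meeting_cyclically_convex:
  fixes D :: "'v \<Rightarrow> 'a::linorder set"
  assumes "finite P" "finite K" "K \<noteq> {}"
    and D: "\<And>v. v \<in> K \<Longrightarrow> D v \<subseteq> P \<and> cyclically_convex P (D v)"
    and meet: "\<And>u v. u \<in> K \<Longrightarrow> v \<in> K \<Longrightarrow> D u \<inter> D v \<noteq> {}"
  obtains p where "p \<in> P" "card K + 1 \<le> 2 * card {v \<in> K. p \<in> D v}"
proof -
  obtain v0 where v0: "v0 \<in> K" and min: "\<And>u. u \<in> K \<Longrightarrow> card (D v0) \<le> card (D u)"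
    using \<open>K \<noteq> {}\<close> ex_has_least_nat[of "\<lambda>v. v \<in> K" _ "\<lambda>v. card (D v)"] by blast
  obtain e f where ef: "e \<in> D v0" "f \<in> D v0"
    and E: "\<And>E. E \<subseteq> P \<Longrightarrow> cyclically_convex P E \<Longrightarrow> E \<inter> D v0 \<noteq> {} \<Longrightarrow> e \<notin> E \<Longrightarrow> f \<notin> E \<Longrightarrow> E \<subset> D v0"
    using cyclically_convex_end_points[of P "D v0"] \<open>finite P\<close> D[OF v0] meet[OF v0 v0] by auto
  have fin: "finite (D v0)" using D[OF v0] \<open>finite P\<close> finite_subset by blast
  let ?N = "\<lambda>p. {v \<in> K. p \<in> D v}"
  have "e \<in> D u \<or> f \<in> D u" if "u \<in> K" for u
  proof (rule ccontr)
    assume "\<not> (e \<in> D u \<or> f \<in> D u)"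
    then have "D u \<subset> D v0" using D[OF that] meet[OF that v0] by (intro E) auto
    then have "card (D u) < card (D v0)" using fin psubset_card_mono by blast
    then show False using min[OF that] by simp
  qed
  then have "?N e \<union> ?N f = K" by blast
  moreover have "card {v0} \<le> card (?N e \<inter> ?N f)"
    using v0 ef \<open>finite K\<close> by (intro card_mono) auto
  moreover have "card (?N e) + card (?N f) = card (?N e \<union> ?N f) + card (?N e \<inter> ?N f)"
    using \<open>finite K\<close> by (intro card_Un_Int) auto
  ultimately have "card K + 1 \<le> card (?N e) + card (?N f)" by simp
  then have "card K + 1 \<le> 2 * card (?N e) \<or> card K + 1 \<le> 2 * card (?N f)" by linarith
  then show thesis using that ef D[OF v0] by blast
qed

text \<open>
  The chord through two points of the circle separates the two arcs between them.  A connected set that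
  avoids the two points and meets both arcs would have to cross the chord inside the circle, away from
  the circle.
\<close>

lemma connected_subset_sphere_cyclically_convex:
  fixes c :: complex
  assumes "0 < r" "C \<subseteq> sphere c r" "connected C"
  shows "cyclically_convex {0..<2 * pi} {s \<in> {0..<2 * pi}. c + of_real r * cis s \<in> C}"
  unfolding cyclically_convex_def
proof (intro ballI impI)
  let ?T = "{s \<in> {0..<2 * pi}. c + of_real r * cis s \<in> C}"
  fix a b assume a: "a \<in> {0..<2 * pi} - ?T" and b: "b \<in> {0..<2 * pi} - ?T" and "a < b"
  \<comment> \<open>The affine function that vanishes on the chord through the points at angles \<open>a\<close> and \<open>b\<close>
    and is positive on the side of the angles between them.\<close>
  define h where "h z = Re ((z - c) * cis (- ((a + b) / 2))) - r * cos ((b - a) / 2)" for z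
  have h: "h (c + of_real r * cis s) = r * (2 * sin ((s - a) / 2) * sin ((b - s) / 2))" for s
  proof -
    have "h (c + of_real r * cis s) = r * (cos (s - (a + b) / 2) - cos ((b - a) / 2))"
      by (simp add: h_def cos_diff algebra_simps)
    also have "cos (s - (a + b) / 2) - cos ((b - a) / 2)
        = 2 * sin ((s - a) / 2) * sin ((b - s) / 2)"
    proof -
      have "(s - (a + b) / 2 + (b - a) / 2) / 2 = (s - a) / 2"
        and "((b - a) / 2 - (s - (a + b) / 2)) / 2 = (b - s) / 2"
        by (simp_all add: field_simps)
      then show ?thesis by (simp only: cos_diff_cos)
    qed
    finally show ?thesis .
  qed
  \<comment> \<open>Half the difference of two angles lies strictly between \<open>-pi\<close> and \<open>pi\<close>, where the sine
    has the sign of its argument; so the factors of \<open>h\<close> vanish only at the angles \<open>a\<close> and \<open>b\<close>.\<close>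
  have sin_pos: "0 < sin ((x - y) / 2)" if "y < x" "x \<in> {0..<2 * pi}" "y \<in> {0..<2 * pi}" for x y
    using that by (intro sin_gt_zero) auto
  have sin_neg: "sin ((x - y) / 2) < 0" if "x < y" "x \<in> {0..<2 * pi}" "y \<in> {0..<2 * pi}" for x y
  proof -
    have "sin ((x - y) / 2) = - sin ((y - x) / 2)"
      by (metis minus_diff_eq minus_divide_left sin_minus)
    then show ?thesis using sin_pos[of x y] that by simp
  qed
  show "?T \<inter> {a<..<b} = {} \<or> ?T \<subseteq> {a<..<b}"
  proof (rule ccontr)
    assume "\<not> (?T \<inter> {a<..<b} = {} \<or> ?T \<subseteq> {a<..<b})"
    then obtain p q where p: "p \<in> ?T" "p \<in> {a<..<b}" and q: "q \<in> ?T" "q \<notin> {a<..<b}"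
      by blast
    have "a < p" "p < b" using p(2) by auto
    have "q \<noteq> a" "q \<noteq> b" using a b q by auto
    have "0 < h (c + of_real r * cis p)"
      using sin_pos[of a p] sin_pos[of p b] p a b \<open>a < p\<close> \<open>p < b\<close> \<open>0 < r\<close> by (simp add: h)
    moreover have "h (c + of_real r * cis q) < 0"
    proof (cases "q < a")
      case True
      then have "sin ((q - a) / 2) < 0" "0 < sin ((b - q) / 2)"
        using sin_neg[of q a] sin_pos[of q b] q a b \<open>a < b\<close> by auto
      then show ?thesis using \<open>0 < r\<close> by (simp add: h mult_less_0_iff mult_pos_neg)
    next
      case False
      then have "b < q" using q(2) \<open>q \<noteq> a\<close> \<open>q \<noteq> b\<close> by auto
      then have "0 < sin ((q - a) / 2)" "sin ((b - q) / 2) < 0"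
        using sin_pos[of a q] sin_neg[of b q] q a b \<open>a < b\<close> by auto
      then show ?thesis using \<open>0 < r\<close> by (simp add: h mult_less_0_iff mult_pos_neg)
    qed
    moreover have "connected (h ` C)"
      unfolding h_def by (intro connected_continuous_image continuous_intros \<open>connected C\<close>)
    ultimately have "0 \<in> h ` C"
      using p q connectedD_interval[of "h ` C" "h (c + of_real r * cis q)" "h (c + of_real r * cis p)" 0]
      by auto
    then obtain z where z: "z \<in> C" "h z = 0" by force
    define s where "s = Arg2pi (z - c)"
    have s: "s \<in> {0..<2 * pi}" using Arg2pi_ge_0 Arg2pi_lt_2pi by (simp add: s_def)
    have "norm (z - c) = r" using z assms by (auto simp: dist_norm norm_minus_commute)
    then have zs: "z = c + of_real r * cis s"
      using Arg2pi_eq[of "z - c"] by (simp add: s_def cis_conv_exp algebra_simps)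
    then have "s \<noteq> a" "s \<noteq> b" using z s a b by auto
    have "sin ((s - a) / 2) \<noteq> 0"
      using sin_pos[of a s] sin_neg[of s a] s a \<open>s \<noteq> a\<close> by (cases "a < s") auto
    moreover have "sin ((b - s) / 2) \<noteq> 0"
      using sin_pos[of s b] sin_neg[of b s] s b \<open>s \<noteq> b\<close> by (cases "s < b") auto
    moreover have "sin ((s - a) / 2) = 0 \<or> sin ((b - s) / 2) = 0"
      using z zs h \<open>0 < r\<close> by auto
    ultimately show False by blast
  qed
qed

text \<open>
  Connected subsets of a circle may lack their end points, so there need not be an end point that belongs to
  the arc.  The way around it is to keep only finitely many points of the circle, one in the
  intersection of each pair of arcs.
\<close>

lemma half_of_meeting_arcs:
  fixes C :: "'v \<Rightarrow> complex set"
  assumes "0 < r" "finite K" "K \<noteq> {}"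
    and C: "\<And>v. v \<in> K \<Longrightarrow> C v \<subseteq> sphere c r \<and> connected (C v)"
    and meet: "\<And>u v. u \<in> K \<Longrightarrow> v \<in> K \<Longrightarrow> C u \<inter> C v \<noteq> {}"
  obtains p where "p \<in> sphere c r" "card K + 1 \<le> 2 * card {v \<in> K. p \<in> C v}"
proof -
  define pt where "pt s = c + of_real r * cis s" for s
  define T where "T v = {s \<in> {0..<2 * pi}. pt s \<in> C v}" for v
  have surj: "\<exists>s\<in>{0..<2 * pi}. pt s = z" if "z \<in> sphere c r" for z
  proof
    have "norm (z - c) = r" using that by (simp add: dist_norm norm_minus_commute)
    then show "pt (Arg2pi (z - c)) = z"
      using Arg2pi_eq[of "z - c"] by (simp add: pt_def cis_conv_exp algebra_simps)
  qed (simp add: Arg2pi_ge_0 Arg2pi_lt_2pi)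
  have "\<exists>s. s \<in> T u \<inter> T v" if uv: "u \<in> K" "v \<in> K" for u v
  proof -
    obtain z where z: "z \<in> C u" "z \<in> C v" using meet[OF uv] by blast
    then have "z \<in> sphere c r" using C[OF uv(1)] by blast
    then obtain s where "s \<in> {0..<2 * pi}" "pt s = z" using surj by blast
    then show ?thesis using z unfolding T_def by blast
  qed
  then obtain g where g: "\<And>u v. u \<in> K \<Longrightarrow> v \<in> K \<Longrightarrow> g u v \<in> T u \<inter> T v"
    by metis
  define P where "P = (\<lambda>(u, v). g u v) ` (K \<times> K)"
  have P: "finite P" "P \<subseteq> {0..<2 * pi}"
    using \<open>finite K\<close> g by (auto simp: P_def T_def)
  have convex: "cyclically_convex P (T v \<inter> P)" if "v \<in> K" for v
  proof -
    have "cyclically_convex {0..<2 * pi} (T v)"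
      unfolding T_def pt_def using connected_subset_sphere_cyclically_convex[OF \<open>0 < r\<close>] C that by blast
    then show ?thesis using P(2) unfolding cyclically_convex_def by blast
  qed
  have "(T u \<inter> P) \<inter> (T v \<inter> P) \<noteq> {}" if "u \<in> K" "v \<in> K" for u v
    using g[OF that] that unfolding P_def by force
  then obtain s where s: "s \<in> P" "card K + 1 \<le> 2 * card {v \<in> K. s \<in> T v \<inter> P}"
    using half_of_meeting_cyclically_convex[of P K "\<lambda>v. T v \<inter> P"] P(1) assms(2,3) convex
    by blast
  have "{v \<in> K. s \<in> T v \<inter> P} = {v \<in> K. pt s \<in> C v}"
    using s P by (auto simp: T_def)
  moreover have "pt s \<in> sphere c r"
    using \<open>0 < r\<close> by (simp add: pt_def dist_norm norm_mult)
  ultimately show thesis using that s by metis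
qed

section \<open>Cylindrical societies\<close>

text \<open>
  Helly's theorem on the line: the largest left end point is in every interval.
\<close>

lemma common_point_of_meeting_intervals:
  fixes I :: "'v \<Rightarrow> 'a::linorder set"
  assumes "finite K" "K \<noteq> {}"
    and I: "\<And>v. v \<in> K \<Longrightarrow> \<exists>a b. I v = {a..b}"
    and meet: "\<And>u v. u \<in> K \<Longrightarrow> v \<in> K \<Longrightarrow> I u \<inter> I v \<noteq> {}"
  obtains x where "\<And>v. v \<in> K \<Longrightarrow> x \<in> I v"
proof -
  obtain a b where ab: "\<And>v. v \<in> K \<Longrightarrow> I v = {a v..b v}"
    using I by metis
  have le: "a u \<le> b v" if "u \<in> K" "v \<in> K" for u v
    using meet[OF that] that by (fastforce simp: ab)
  show thesis
  proof (rule that)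
    fix v assume v: "v \<in> K"
    then show "Max (a ` K) \<in> I v"
      using \<open>finite K\<close> \<open>K \<noteq> {}\<close> le[OF _ v] by (auto simp: ab)
  qed
qed

lemma card_approving_le_agreement_number:
  assumes "finite (voters S)" "p \<in> spectrum S"
  shows "card {v \<in> voters S. p \<in> approval S v} \<le> agreement_number S"
  unfolding agreement_number_def
proof (rule Max_ge)
  \<comment> \<open>The spectrum may be infinite, but only finitely many numbers of approving voters occur.\<close>
  have "(\<lambda>p. card {v \<in> voters S. p \<in> approval S v}) ` spectrum S \<subseteq> {..card (voters S)}"
    using assms(1) by (auto intro: card_mono)
  then show "finite ((\<lambda>p. card {v \<in> voters S. p \<in> approval S v}) ` spectrum S)"
    using finite_subset by blast
qed (use assms in blast)

text \<open>
  For pairwise meeting boxes, the first coordinates have a common point, whereas the second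
  coordinates in general only have a point common to just over half of them.
\<close>

theorem theorem12:
  fixes k m :: nat and S :: "(real \<times> complex, 'v) society"
  assumes "2 \<le> k" and "k \<le> m" and "m \<le> 2 * k - 2"
    and "cylindrical_society S"
    and "agreeable k m S"
  shows "real (agreement_number S) \<ge> (real (society_size S) - real m + real k + 1) / 2"
proof -
  obtain L C where LC: "linear_society L" "circular_society C" "is_product_society S L C"
    using assms(4) unfolding cylindrical_society_def by blast
  let ?V = "voters S"
  have prod: "voters L = ?V" "voters C = ?V" "spectrum S = spectrum L \<times> spectrum C"
    and app: "\<And>v. v \<in> ?V \<Longrightarrow> approval S v = approval L v \<times> approval C v"
    using LC(3) unfolding is_product_society_def by auto
  have finV: "finite ?V" and subL: "\<And>v. v \<in> ?V \<Longrightarrow> approval L v \<subseteq> spectrum L"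
    and L: "\<And>v. v \<in> ?V \<Longrightarrow> \<exists>a b. approval L v = {a..b}"
    using LC(1) prod unfolding linear_society_def society_def by auto
  obtain c r where cr: "0 < r" "spectrum C = sphere c r"
    and C: "\<And>v. v \<in> ?V \<Longrightarrow> approval C v \<subseteq> sphere c r \<and> connected (approval C v)"
    using LC(2) prod unfolding circular_society_def society_def by metis
  define R where "R = {(u, v). approval S u \<inter> approval S v \<noteq> {}}"
  have "m \<le> card ?V"
    using assms(5) unfolding agreeable_def society_size_def by blast
  have local: "\<exists>K\<subseteq>M. card K = k \<and> K \<times> K \<subseteq> R" if M: "M \<subseteq> ?V" "card M = m" for M
  proof -
    have "\<exists>K\<subseteq>M. card K = k \<and> (\<exists>p\<in>spectrum S. \<forall>v\<in>K. p \<in> approval S v)"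
      using assms(5) M unfolding agreeable_def by simp
    then obtain K p where K: "K \<subseteq> M" "card K = k" "\<forall>v\<in>K. p \<in> approval S v"
      by blast
    then have "K \<times> K \<subseteq> R" unfolding R_def by blast
    then show ?thesis using K by blast
  qed
  have "m + 2 \<le> 2 * k" using assms(1,3) by linarith
  then obtain K where K: "K \<subseteq> ?V" "K \<times> K \<subseteq> R" "card ?V - (m - k) \<le> card K"
    using clique_of_cliques_in_small_sets[OF finV \<open>m \<le> card ?V\<close> \<open>k \<le> m\<close> _ local] by metis
  have finK: "finite K" using K(1) finV finite_subset by blast
  have "K \<noteq> {}" using K(3) \<open>m \<le> card ?V\<close> assms(1,2) by auto
  have meet: "approval L u \<inter> approval L v \<noteq> {}" "approval C u \<inter> approval C v \<noteq> {}"
    if "u \<in> K" "v \<in> K" for u v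
  proof -
    have "(u, v) \<in> R" using K(2) that by blast
    then have "(approval L u \<times> approval C u) \<inter> (approval L v \<times> approval C v) \<noteq> {}"
      using app K(1) that unfolding R_def by (metis (mono_tags, lifting) case_prodD mem_Collect_eq subsetD)
    then show "approval L u \<inter> approval L v \<noteq> {}" "approval C u \<inter> approval C v \<noteq> {}" by auto
  qed
  obtain x where x: "\<And>v. v \<in> K \<Longrightarrow> x \<in> approval L v"
    using common_point_of_meeting_intervals[OF finK \<open>K \<noteq> {}\<close>, of "approval L"] L K(1) meet(1) by blast
  obtain p where p: "p \<in> sphere c r" "card K + 1 \<le> 2 * card {v \<in> K. p \<in> approval C v}"
    using half_of_meeting_arcs[OF cr(1) finK \<open>K \<noteq> {}\<close>, of "approval C"] C K(1) meet(2) by blast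
  have "x \<in> spectrum L" using x subL K(1) \<open>K \<noteq> {}\<close> by blast
  then have "(x, p) \<in> spectrum S" using p cr prod by simp
  have "card {v \<in> K. p \<in> approval C v} \<le> card {v \<in> ?V. (x, p) \<in> approval S v}"
    using finV K(1) x app by (intro card_mono) auto
  also have "\<dots> \<le> agreement_number S"
    by (rule card_approving_le_agreement_number[OF finV \<open>(x, p) \<in> spectrum S\<close>])
  finally have "card ?V + k + 1 \<le> 2 * agreement_number S + m"
    using p(2) K(3) \<open>k \<le> m\<close> by linarith
  then have "real (card ?V + k + 1) \<le> real (2 * agreement_number S + m)" by (rule of_nat_mono)
  then show ?thesis unfolding society_size_def by simp
qed

end
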